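(* Let $p$ be an odd prime, $r\ge1$, $q=p^r$, and suppose $-1$ is a quadratic non-residue in $GF(q)$. Let $m\ge1$, let $N\mid(q^m-1)$, and let $\alpha\in GF(q^m)$ be a specified element of multiplicative order $N$. A vector $V=(V_0,\dots,V_{N-1})$ with components $V_k\in GF(q^m)$ is the finite field Hartley spectrum (with respect to $\alpha$) of a signal $v=(v_0,\dots,v_{N-1})$ with all $v_i\in GF(q)$ if and only if $$V_k^{\,q}=V_{N-kq}\qquad\text{for all } k=0,1,\dots,N-1,$$ where indices are considered modulo $N$.
   Context: $GF(q)$ is the finite field with $q$ elements, and $j$ denotes a square root of $-1$ (so $j^2=-1$) in an extension field of $GF(q^m)$. For $\alpha\in GF(q^m)$ of multiplicative order $N$ and integers $i,k$ (taken modulo $N$), define $$\cos_k(\angle\alpha^i):=\tfrac12(\alpha^{ik}+\alpha^{-ik}),\qquad \sin_k(\angle\alpha^i):=\tfrac{1}{2j}(\alpha^{ik}-\alpha^{-ik}),\qquad \mathrm{cas}_k(\angle\alpha^i):=\cos_k(\angle\alpha^i)+\sin_k(\angle\alpha^i).$$ The symbol $\angle$ is only notation. The finite field Hartley transform (spectrum) of a vector $v=(v_0,\dots,v_{N-1})$ with components in $GF(q)$, with respect to $\alpha$, is the vector $V=(V_0,\dots,V_{N-1})$ with components $V_k$, taken in $GF(q^m)$, given by $$V_k:=\sum_{i=0}^{N-1}v_i\,\mathrm{cas}_k(\angle\alpha^i),\qquad k=0,1,\dots,N-1.$$ *)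

theory Defs
  imports
    "HOL-Computational_Algebra.Primes"
    "HOL-Algebra.Multiplicative_Group"
    "HOL-Algebra.Subrings"
begin

text \<open>
  All fields live inside one ambient field \<open>L\<close>, which contains the chosen square root \<open>j\<close>
  of \<open>-1\<close>; the finite fields with \<open>q\<close> and \<open>q ^ m\<close> elements are subfields of \<open>L\<close>.
  The trigonometric functions and the transform take values in \<open>L\<close>. The argument order is
  that of the subscript \<open>k\<close> first, then the exponent \<open>i\<close> of \<open>\<alpha>\<close>.
\<close>

definition ff_cos :: "('a, 'b) ring_scheme \<Rightarrow> 'a \<Rightarrow> int \<Rightarrow> int \<Rightarrow> 'a" where
  "ff_cos L \<alpha> k i =
     inv\<^bsub>L\<^esub> (\<one>\<^bsub>L\<^esub> \<oplus>\<^bsub>L\<^esub> \<one>\<^bsub>L\<^esub>) \<otimes>\<^bsub>L\<^esub> (\<alpha> [^]\<^bsub>L\<^esub> (i * k) \<oplus>\<^bsub>L\<^esub> \<alpha> [^]\<^bsub>L\<^esub> (- (i * k)))"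

definition ff_sin :: "('a, 'b) ring_scheme \<Rightarrow> 'a \<Rightarrow> 'a \<Rightarrow> int \<Rightarrow> int \<Rightarrow> 'a" where
  "ff_sin L j \<alpha> k i =
     inv\<^bsub>L\<^esub> ((\<one>\<^bsub>L\<^esub> \<oplus>\<^bsub>L\<^esub> \<one>\<^bsub>L\<^esub>) \<otimes>\<^bsub>L\<^esub> j) \<otimes>\<^bsub>L\<^esub> (\<alpha> [^]\<^bsub>L\<^esub> (i * k) \<ominus>\<^bsub>L\<^esub> \<alpha> [^]\<^bsub>L\<^esub> (- (i * k)))"

definition ff_cas :: "('a, 'b) ring_scheme \<Rightarrow> 'a \<Rightarrow> 'a \<Rightarrow> int \<Rightarrow> int \<Rightarrow> 'a" where
  "ff_cas L j \<alpha> k i = ff_cos L \<alpha> k i \<oplus>\<^bsub>L\<^esub> ff_sin L j \<alpha> k i"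

text \<open>Vectors of length \<open>N\<close> are functions on \<open>nat\<close> of which only the values below \<open>N\<close> matter.\<close>

definition ff_hartley ::
  "('a, 'b) ring_scheme \<Rightarrow> 'a \<Rightarrow> 'a \<Rightarrow> nat \<Rightarrow> (nat \<Rightarrow> 'a) \<Rightarrow> nat \<Rightarrow> 'a" where
  "ff_hartley L j \<alpha> N v k =
     (\<Oplus>\<^bsub>L\<^esub>i\<in>{..<N}. v i \<otimes>\<^bsub>L\<^esub> ff_cas L j \<alpha> (int k) (int i))"

end

theory Submission
  imports Defs "HOL-Algebra.Polynomial_Divisibility"
begin

text \<open>
  The Hartley kernel is symmetric and orthogonal, so \<open>v = V\<^sup>\<and> / N\<close> is the only possible signal with
  spectrum \<open>V\<close>, where \<open>V\<^sup>\<and>\<close> is the Hartley transform of \<open>V\<close>. As \<open>-1\<close> is a non-residue,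
  \<open>j ^ q = - j\<close>, hence \<open>x \<mapsto> x ^ q\<close> maps \<open>cas\<^sub>k\<close> to the kernel with index \<open>- k * q\<close>. For a signal
  over \<open>GF(q)\<close>, applying this map to the transform gives the conjugacy condition. Conversely, the
  condition makes the map merely permute the summands of the inversion formula by
  \<open>k \<mapsto> - k * q\<close>, so each \<open>v\<^sub>i\<close> is a root of \<open>x ^ q = x\<close> and therefore lies in \<open>GF(q)\<close>.
\<close>

hide_const (open) Divisibility.prime Ring_Divisibility.mult_of

section \<open>Frobenius maps and finite sums in commutative rings\<close>

context cring
begin

text \<open>Pascal's rule, by induction on \<open>n\<close> after splitting off one factor
  \<open>a \<oplus> b\<close>.\<close>

lemma binomial_theorem:
  assumes a: "a \<in> carrier R" and b: "b \<in> carrier R"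
  shows "(a \<oplus> b) [^] (n::nat) = (\<Oplus>k\<in>{..n}. [(n choose k)] \<cdot> (a [^] k \<otimes> b [^] (n - k)))"
proof (induction n)
  case 0
  show ?case using a b by simp
next
  case (Suc n)
  let ?T = "\<lambda>k. [(n choose k)] \<cdot> (a [^] k \<otimes> b [^] (n - k))"
  let ?W = "\<lambda>k. [(n choose k)] \<cdot> (a [^] k \<otimes> b [^] (Suc n - k))"
  let ?S = "\<Oplus>k\<in>{..n}. ?T k"
  have "b \<otimes> ?S = (\<Oplus>k\<in>{..n}. b \<otimes> ?T k)"
    using a b by (intro finsum_rdistr) auto
  also have "\<dots> = (\<Oplus>k\<in>{..n}. ?W k)"
    using a b by (intro finsum_cong') (auto simp: add_pow_rdistr Suc_diff_le m_ac)
  \<comment> \<open>The new top term has coefficient \<open>n choose Suc n = 0\<close>; with it in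
    place the index can be shifted to match the sum for \<open>a \<otimes> ?S\<close>.\<close>
  also have "\<dots> = (\<Oplus>k\<in>{..Suc n}. ?W k)"
    using a b by (subst finsum_Suc) (auto simp: binomial_eq_0)
  also have "\<dots> = (\<Oplus>k\<in>{..n}. ?W (Suc k)) \<oplus> ?W 0"
    using a b by (intro finsum_Suc2) auto
  finally have bS: "b \<otimes> ?S = (\<Oplus>k\<in>{..n}. ?W (Suc k)) \<oplus> ?W 0" .
  have aS: "a \<otimes> ?S = (\<Oplus>k\<in>{..n}. a \<otimes> ?T k)"
    using a b by (intro finsum_rdistr) auto
  have "(\<Oplus>k\<in>{..Suc n}. [(Suc n choose k)] \<cdot> (a [^] k \<otimes> b [^] (Suc n - k)))
      = (\<Oplus>k\<in>{..n}. [(Suc n choose Suc k)] \<cdot> (a [^] Suc k \<otimes> b [^] (n - k))) \<oplus> ?W 0"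
    using a b by (subst finsum_Suc2) auto
  also have "(\<Oplus>k\<in>{..n}. [(Suc n choose Suc k)] \<cdot> (a [^] Suc k \<otimes> b [^] (n - k)))
      = (\<Oplus>k\<in>{..n}. a \<otimes> ?T k \<oplus> ?W (Suc k))"
    using a b by (intro finsum_cong')
      (auto simp: add_pow_rdistr m_ac simp flip: add.nat_pow_mult)
  also have "\<dots> = (\<Oplus>k\<in>{..n}. a \<otimes> ?T k) \<oplus> (\<Oplus>k\<in>{..n}. ?W (Suc k))"
    using a b by (intro finsum_addf) auto
  finally have "(\<Oplus>k\<in>{..Suc n}. [(Suc n choose k)] \<cdot> (a [^] k \<otimes> b [^] (Suc n - k)))
      = a \<otimes> ?S \<oplus> b \<otimes> ?S"
    unfolding aS bS using a b by (simp add: a_assoc)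
  also have "\<dots> = (a \<oplus> b) [^] Suc n"
    using a b by (simp add: Suc.IH l_distr m_comm)
  finally show ?case ..
qed

lemma add_pow_dvd_zero:
  assumes "[(p::nat)] \<cdot> \<one> = \<zero>" "p dvd n" "x \<in> carrier R"
  shows "[n] \<cdot> x = \<zero>"
proof -
  obtain k where "n = p * k" using assms(2) by (elim dvdE)
  hence "[n] \<cdot> \<one> = [k] \<cdot> ([p] \<cdot> \<one>)" by (simp add: add.nat_pow_pow)
  hence "[n] \<cdot> \<one> = \<zero>" by (simp add: assms(1))
  thus ?thesis using add_pow_ldistr[of \<one> x n] assms(3) by simp
qed

text \<open>For \<open>0 < k < p\<close> the prime divides \<open>p choose k\<close>, so only the
  two outer binomial terms survive.\<close>

lemma frobenius_add_prime:
  assumes p: "prime (p::nat)" "[p] \<cdot> \<one> = \<zero>" and a: "a \<in> carrier R" and b: "b \<in> carrier R"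
  shows "(a \<oplus> b) [^] p = a [^] p \<oplus> b [^] p"
proof -
  let ?f = "\<lambda>k. [(p choose k)] \<cdot> (a [^] k \<otimes> b [^] (p - k))"
  obtain n where n: "p = Suc n" using prime_gt_0_nat[OF p(1)] gr0_implies_Suc by blast
  have "(\<Oplus>k\<in>{..n}. ?f k) = (\<Oplus>k\<in>{..n}. if 0 = k then ?f k else \<zero>)"
  proof (intro finsum_cong' refl)
    fix k assume k: "k \<in> {..n}"
    show "?f k = (if 0 = k then ?f k else \<zero>)"
    proof (cases "k = 0")
      case False
      then have "p dvd (p choose k)"
        using k n p(1) by (intro dvd_choose_prime) auto
      then show ?thesis using add_pow_dvd_zero[OF p(2)] a b False by simp
    qed auto
  qed (use a b in auto)
  also have "\<dots> = ?f 0" using a b by (intro finsum_singleton) auto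
  finally have "(\<Oplus>k\<in>{..n}. ?f k) = b [^] p" using a b by simp
  moreover have "(\<Oplus>k\<in>{..p}. ?f k) = ?f p \<oplus> (\<Oplus>k\<in>{..n}. ?f k)"
    unfolding n using a b by (intro finsum_Suc) auto
  ultimately show ?thesis using a b by (simp add: binomial_theorem)
qed

lemma frobenius_add:
  assumes p: "prime (p::nat)" "[p] \<cdot> \<one> = \<zero>" and a: "a \<in> carrier R" and b: "b \<in> carrier R"
  shows "(a \<oplus> b) [^] (p ^ r) = a [^] (p ^ r) \<oplus> b [^] (p ^ r)"
proof (induction r)
  case (Suc r)
  have "x [^] (p ^ Suc r) = (x [^] (p ^ r)) [^] p" if "x \<in> carrier R" for x
    using that by (simp add: nat_pow_pow mult.commute)
  then show ?case using a b Suc frobenius_add_prime[OF p] by simp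
qed (use a b in simp)

lemma frobenius_finsum:
  assumes p: "prime (p::nat)" "[p] \<cdot> \<one> = \<zero>" and "finite A" "f \<in> A \<rightarrow> carrier R"
  shows "(\<Oplus>i\<in>A. f i) [^] (p ^ r) = (\<Oplus>i\<in>A. f i [^] (p ^ r))"
  using assms(3,4)
proof (induction A rule: finite_induct)
  case empty
  \<comment> \<open>The empty sum requires \<open>\<zero> [^] (p ^ r) = \<zero>\<close>, which
    relies on a nonzero exponent.\<close>
  have "p ^ r \<noteq> 0" using prime_gt_0_nat[OF p(1)] by simp
  then show ?case by (metis finsum_empty nat_pow_zero)
next
  case (insert x A)
  then show ?case by (simp add: frobenius_add[OF p] Pi_def)
qed

lemma finsum_swap:
  assumes "finite A" "finite B" "\<And>i k. i \<in> A \<Longrightarrow> k \<in> B \<Longrightarrow> f i k \<in> carrier R"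
  shows "(\<Oplus>i\<in>A. \<Oplus>k\<in>B. f i k) = (\<Oplus>k\<in>B. \<Oplus>i\<in>A. f i k)"
  using assms(1,3)
proof (induction A rule: finite_induct)
  case (insert x A)
  have "(\<Oplus>i\<in>insert x A. \<Oplus>k\<in>B. f i k) = (\<Oplus>k\<in>B. f x k) \<oplus> (\<Oplus>k\<in>B. \<Oplus>i\<in>A. f i k)"
    using insert by (subst finsum_insert) (auto intro!: finsum_closed)
  also have "\<dots> = (\<Oplus>k\<in>B. f x k \<oplus> (\<Oplus>i\<in>A. f i k))"
    using insert by (intro finsum_addf[symmetric]) (auto intro!: finsum_closed)
  also have "\<dots> = (\<Oplus>k\<in>B. \<Oplus>i\<in>insert x A. f i k)"
    using insert by (intro finsum_cong') (auto intro!: finsum_closed)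
  finally show ?case .
qed auto

text \<open>Additivity applied to \<open>\<ominus> x \<oplus> x\<close>, which treats
  \<open>p = 2\<close> and odd \<open>p\<close> alike.\<close>

lemma frobenius_minus:
  assumes p: "prime (p::nat)" "[p] \<cdot> \<one> = \<zero>" and x: "x \<in> carrier R"
  shows "(\<ominus> x) [^] (p ^ r) = \<ominus> (x [^] (p ^ r))"
proof -
  have "p ^ r \<noteq> 0" using prime_gt_0_nat[OF p(1)] by simp
  then have "(\<ominus> x) [^] (p ^ r) \<oplus> x [^] (p ^ r) = \<zero>"
    using frobenius_add[OF p, of "\<ominus> x" x r] x by (simp add: l_neg nat_pow_zero)
  then show ?thesis using x by (intro minus_equality[symmetric]) auto
qed

text \<open>\<open>[n] \<cdot> \<one>\<close> is a sum of copies of \<open>\<one>\<close>, each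
  fixed by the map. This will show that the factor \<open>1 / N\<close> of the inversion formula is
  fixed.\<close>

lemma frobenius_add_pow_one:
  assumes p: "prime (p::nat)" "[p] \<cdot> \<one> = \<zero>"
  shows "([n] \<cdot> \<one>) [^] (p ^ r) = [(n::nat)] \<cdot> \<one>"
  using frobenius_finsum[OF p, of "{..<n}" "\<lambda>_. \<one>" r] add.finprod_const[of \<one> "{..<n}"] by simp

lemma Units_inv_pow:
  assumes "x \<in> Units R"
  shows "(inv x) [^] (n::nat) = inv (x [^] n)"
proof (rule comm_inv_char[symmetric])
  show "x [^] n \<otimes> inv x [^] n = \<one>"
    using assms nat_pow_distrib[of x "inv x" n] by (simp add: Units_closed)
qed (use assms in auto)

text \<open>Telescoping, in division-free form. In a field, \<open>g [^] n = \<one>\<close> with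
  \<open>g \<noteq> \<one>\<close> then forces the sum to vanish.\<close>

lemma geometric_finsum:
  assumes "g \<in> carrier R"
  shows "(g \<ominus> \<one>) \<otimes> (\<Oplus>k\<in>{..<n::nat}. g [^] k) = g [^] n \<ominus> \<one>"
proof (induction n)
  case (Suc n)
  have "(\<Oplus>k\<in>{..<Suc n}. g [^] k) = g [^] n \<oplus> (\<Oplus>k\<in>{..<n}. g [^] k)"
    unfolding lessThan_Suc using assms by (intro finsum_insert) auto
  then have "(g \<ominus> \<one>) \<otimes> (\<Oplus>k\<in>{..<Suc n}. g [^] k) = (g \<ominus> \<one>) \<otimes> g [^] n \<oplus> (g [^] n \<ominus> \<one>)"
    using assms Suc by (simp add: r_distr)
  also have "\<dots> = g [^] Suc n \<ominus> \<one>"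
    using assms nat_pow_closed[OF assms, of n] unfolding nat_pow_Suc by algebra
  finally show ?case .
qed (use assms in \<open>simp add: minus_eq r_neg\<close>)

end

section \<open>Characteristic of a domain\<close>

context domain
begin

lemma add_pow_one_mult: "[(m * n :: nat)] \<cdot> \<one> = ([m] \<cdot> \<one>) \<otimes> ([n] \<cdot> \<one>)"
  using add_pow_ldistr[of \<one> "[n] \<cdot> \<one>" m] by (simp add: add.nat_pow_pow mult.commute)

text \<open>The left side is the \<open>r\<close>-th power of \<open>[p] \<cdot> \<one>\<close>, and
  there are no zero divisors. This extracts characteristic \<open>p\<close> from a field of
  \<open>p ^ r\<close> elements.\<close>

lemma add_pow_one_prime_power:
  assumes "[(p ^ r :: nat)] \<cdot> \<one> = \<zero>"
  shows "[p] \<cdot> \<one> = \<zero>"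
  using assms
proof (induction r)
  case (Suc r)
  then show ?case by (simp add: add_pow_one_mult integral_iff) blast
qed simp

end

section \<open>Roots of unity, and finite subfields as fixed points of a power map\<close>

context field
begin

text \<open>These are the roots of \<open>X ^ n - 1\<close>, and the multiset of roots is bounded by
  the degree.\<close>

lemma card_roots_of_unity:
  assumes "n > 0"
  shows "finite {x \<in> carrier R. x [^] (n::nat) = \<one>}" "card {x \<in> carrier R. x [^] n = \<one>} \<le> n"
proof -
  \<comment> \<open>Coefficients of \<open>X ^ n - 1\<close>, leading one first; there are
    \<open>n + 1\<close> of them because \<open>n > 0\<close>.\<close>
  let ?p = "\<one> # (replicate (n - 1) \<zero> @ [\<ominus> \<one>])"
  let ?A = "{x \<in> carrier R. x [^] n = \<one>}"
  have pc: "?p \<in> carrier (poly_ring R)"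
    by (auto simp: univ_poly_def polynomial_def)
  have ev: "eval ?p x = x [^] n \<ominus> \<one>" if "x \<in> carrier R" for x
  proof -
    have "eval (replicate (n - 1) \<zero> @ [\<ominus> \<one>]) x = \<ominus> \<one>"
      using that eval_replicate[of "[\<ominus> \<one>]" x "n - 1"] by simp
    then show ?thesis using that assms by (simp add: minus_eq)
  qed
  have root: "x \<in># roots ?p" if "x \<in> ?A" for x
    using that ev[of x] unfolding roots_mem_iff_is_root[OF pc] is_root_def by auto
  hence sub: "?A \<subseteq> set_mset (roots ?p)" by blast
  show "finite ?A" using finite_subset[OF sub] by simp
  have "card ?A \<le> card (set_mset (roots ?p))" using sub by (intro card_mono) auto
  also have "\<dots> \<le> size (roots ?p)"
    by (metis mset_set_set_mset_msubset size_mset_mono size_mset_set)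
  also have "\<dots> \<le> n" using size_roots_le_degree[OF pc] assms by simp
  finally show "card ?A \<le> n" .
qed

text \<open>Lagrange in the additive group of \<open>F\<close>; for infinite \<open>F\<close> the
  convention \<open>card F = 0\<close> makes it trivial.\<close>

lemma subfield_add_pow_card:
  assumes "subfield F R"
  shows "[card F] \<cdot> \<one> = \<zero>"
proof -
  interpret F: field "R\<lparr>carrier := F\<rparr>" by (rule subfield_iff(2)[OF assms])
  have "[card F] \<cdot>\<^bsub>R\<lparr>carrier := F\<rparr>\<^esub> \<one> = \<zero>"
    using F.add.pow_order_eq_1[of \<one>] F.one_closed by (simp add: order_def)
  thus ?thesis by (simp add: add_pow_def nat_pow_def)
qed

text \<open>Lagrange in the multiplicative group of \<open>F\<close>, of order
  \<open>card F - 1\<close>, followed by one more factor \<open>x\<close>.\<close>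

lemma subfield_power_card:
  assumes "subfield F R" "finite F" "x \<in> F"
  shows "x [^] card F = x"
proof (cases "x = \<zero>")
  case True
  have "card F \<noteq> 0" using assms by auto
  with True show ?thesis by (simp add: nat_pow_zero)
next
  case False
  interpret F: field "R\<lparr>carrier := F\<rparr>" by (rule subfield_iff(2)[OF assms(1)])
  have xc: "x \<in> carrier R" using assms subfieldE(3) by blast
  have "x [^]\<^bsub>mult_of (R\<lparr>carrier := F\<rparr>)\<^esub> order (mult_of (R\<lparr>carrier := F\<rparr>))
      = \<one>\<^bsub>mult_of (R\<lparr>carrier := F\<rparr>)\<^esub>"
    using assms False by (intro group.pow_order_eq_1 F.field_mult_group) auto
  then have "x [^] (card F - 1) = \<one>"
    using F.order_mult_of assms(2) by (simp add: order_def nat_pow_def)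
  moreover have "card F = Suc (card F - 1)" using assms card_gt_0_iff[of F] by auto
  ultimately show ?thesis using xc by (metis nat_pow_Suc l_one)
qed

text \<open>The nonzero elements of \<open>F\<close> are already \<open>card F - 1\<close> roots of
  \<open>X ^ (card F - 1) - 1\<close>, the most it can have, so no further root exists outside
  \<open>F\<close>.\<close>

lemma subfield_fixed_points:
  assumes "subfield F R" "finite F" "x \<in> carrier R" "x [^] card F = x"
  shows "x \<in> F"
proof (cases "x = \<zero>")
  case True
  with subringE(2)[OF subfieldE(1)[OF assms(1)]] show ?thesis by simp
next
  case False
  let ?n = "card F - 1"
  have F: "F \<subseteq> carrier R" "\<zero> \<in> F" "\<one> \<in> F"
    using subfieldE[OF assms(1)] subringE[OF subfieldE(1)[OF assms(1)]] by auto
  \<comment> \<open>\<open>F\<close> contains both \<open>\<zero>\<close> and \<open>\<one>\<close>,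
    so the exponent \<open>?n\<close> is positive, as the root count demands.\<close>
  have two: "card {\<zero>, \<one>} \<le> card F" using F assms(2) by (intro card_mono) auto
  hence n: "?n > 0" "card F = Suc ?n" by auto
  have unity: "y [^] ?n = \<one>" if "y \<in> carrier R" "y \<noteq> \<zero>" "y [^] card F = y" for y
  proof -
    have "y [^] ?n \<otimes> y = \<one> \<otimes> y" using that n(2) by (metis nat_pow_Suc l_one)
    then show ?thesis using that m_rcancel by blast
  qed
  let ?A = "{y \<in> carrier R. y [^] ?n = \<one>}"
  have sub: "F - {\<zero>} \<subseteq> ?A"
    using unity subfield_power_card[OF assms(1,2)] F by blast
  have "F - {\<zero>} = ?A"
    using card_roots_of_unity[OF n(1)] sub F assms(2)
    by (intro card_seteq) (auto simp: card_Diff_singleton)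
  with unity[OF assms(3) False assms(4)] assms(3) show ?thesis by blast
qed

text \<open>Transfers facts on element orders from the group \<open>mult_of R\<close> to powers
  written in \<open>R\<close>; the inverses behind negative exponents agree on nonzero
  elements.\<close>

lemma int_pow_mult_of:
  assumes "x \<in> carrier R - {\<zero>}"
  shows "x [^]\<^bsub>mult_of R\<^esub> (z::int) = x [^] z"
proof -
  interpret M: group "mult_of R" by (rule field_mult_group)
  have "x [^]\<^bsub>mult_of R\<^esub> n \<in> carrier (mult_of R)" for n :: nat
    using assms by (intro M.nat_pow_closed) simp
  then have "inv\<^bsub>mult_of R\<^esub> (x [^]\<^bsub>mult_of R\<^esub> n) = inv (x [^]\<^bsub>mult_of R\<^esub> n)" for n :: nat
    by (rule m_inv_mult_of)
  then show ?thesis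
    unfolding int_pow_def2 Multiplicative_Group.nat_pow_mult_of by (simp only:)
qed

end

section \<open>The Hartley kernel: orthogonality, inversion and Frobenius action\<close>

locale hartley_kernel = field R for R (structure) +
  fixes \<alpha> j :: 'a and N :: nat
  assumes alpha: "\<alpha> \<in> carrier R - {\<zero>}"
    and ord_alpha: "group.ord (mult_of R) \<alpha> = N"
    and j_closed [simp]: "j \<in> carrier R"
    and j_square: "j \<otimes> j = \<ominus> \<one>"
    and two_nonzero: "\<one> \<oplus> \<one> \<noteq> \<zero>"
begin

sublocale M: group "mult_of R" by (rule field_mult_group)

lemma alpha_pow_closed [simp]: "\<alpha> [^] (z::int) \<in> carrier R"
  using M.int_pow_closed[of \<alpha> z] alpha by (simp add: int_pow_mult_of)

lemma alpha_pow_add: "\<alpha> [^] (y + z :: int) = \<alpha> [^] y \<otimes> \<alpha> [^] z"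
  using M.int_pow_mult[of \<alpha> y z] alpha by (simp add: int_pow_mult_of)

lemma alpha_pow_eq_one_iff: "\<alpha> [^] (z::int) = \<one> \<longleftrightarrow> int N dvd z"
  using M.int_pow_eq_id[of \<alpha> z] alpha by (simp add: int_pow_mult_of ord_alpha)

lemma alpha_pow_cong:
  assumes "int N dvd y - z"
  shows "\<alpha> [^] y = \<alpha> [^] z"
  using alpha_pow_add[of "y - z" z] assms alpha_pow_eq_one_iff[of "y - z"] by simp

lemma alpha_pow_pow: "(\<alpha> [^] (z::int)) [^] (n::nat) = \<alpha> [^] (z * int n)"
proof (induction n)
  case (Suc n)
  then show ?case by (simp add: algebra_simps alpha_pow_add m_comm)
qed simp

text \<open>Put \<open>g = \<alpha> [^] z\<close>. Either \<open>g = \<one>\<close> and every term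
  is \<open>\<one>\<close>, or \<open>g \<noteq> \<one>\<close> and the geometric sum vanishes since
  \<open>g [^] N = \<one>\<close>.\<close>

lemma finsum_alpha_pow:
  "(\<Oplus>k\<in>{..<N}. \<alpha> [^] (int k * z)) = (if int N dvd z then [N] \<cdot> \<one> else \<zero>)"
proof (cases "int N dvd z")
  case True
  then have "(\<Oplus>k\<in>{..<N}. \<alpha> [^] (int k * z)) = (\<Oplus>k\<in>{..<N}. \<one>)"
    by (intro finsum_cong') (auto simp: alpha_pow_eq_one_iff)
  then show ?thesis using True add.finprod_const[of \<one> "{..<N}"] by simp
next
  case False
  define g where "g = \<alpha> [^] z"
  have g: "g \<in> carrier R" "g \<noteq> \<one>" "g [^] N = \<one>"
    using False by (auto simp: g_def alpha_pow_eq_one_iff alpha_pow_pow)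
  have "(g \<ominus> \<one>) \<otimes> (\<Oplus>k\<in>{..<N}. g [^] k) = \<zero>"
    using g by (simp add: geometric_finsum)
  moreover have "g \<ominus> \<one> \<noteq> \<zero>" using g by simp
  ultimately have "(\<Oplus>k\<in>{..<N}. g [^] k) = \<zero>"
    using g by (metis integral finsum_closed Pi_I minus_closed nat_pow_closed one_closed)
  then show ?thesis using False by (simp add: g_def alpha_pow_pow mult.commute)
qed

text \<open>Since \<open>1 / j = - j\<close>, we have \<open>cas\<^sub>k(i) = a * \<alpha>\<^sup>i\<^sup>k + b * \<alpha>\<^sup>-\<^sup>i\<^sup>k\<close> with \<open>a = (1 - j) / 2\<close> and \<open>b = (1 + j) / 2\<close>.\<close>

definition cas_pos :: 'a where "cas_pos = inv (\<one> \<oplus> \<one>) \<otimes> (\<one> \<ominus> j)"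

definition cas_neg :: 'a where "cas_neg = inv (\<one> \<oplus> \<one>) \<otimes> (\<one> \<oplus> j)"

lemma half_closed [simp]: "inv (\<one> \<oplus> \<one>) \<in> carrier R"
  using two_nonzero by (simp add: field_Units)

lemma half_two: "inv (\<one> \<oplus> \<one>) \<otimes> (\<one> \<oplus> \<one>) = \<one>"
  using two_nonzero by (simp add: field_Units)

lemma cas_pos_closed [simp]: "cas_pos \<in> carrier R"
  and cas_neg_closed [simp]: "cas_neg \<in> carrier R"
  by (simp_all add: cas_pos_def cas_neg_def)

text \<open>A multiple of \<open>1 + j * j = 0\<close>. It removes the terms in \<open>k + l\<close>
  from the orthogonality sum.\<close>

lemma cas_coeff_squares: "cas_pos \<otimes> cas_pos \<oplus> cas_neg \<otimes> cas_neg = \<zero>"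
proof -
  have "cas_pos \<otimes> cas_pos \<oplus> cas_neg \<otimes> cas_neg
      = inv (\<one> \<oplus> \<one>) \<otimes> inv (\<one> \<oplus> \<one>) \<otimes> ((\<one> \<oplus> \<one>) \<otimes> (\<one> \<oplus> j \<otimes> j))"
    unfolding cas_pos_def cas_neg_def using half_closed j_closed by algebra
  also have "\<dots> = \<zero>" by (simp add: j_square r_neg)
  finally show ?thesis .
qed

text \<open>Equals \<open>(1 - j * j) / 2\<close>. It is the weight of the terms in
  \<open>k - l\<close> in the orthogonality sum.\<close>

lemma cas_coeff_mult: "cas_pos \<otimes> cas_neg \<oplus> cas_pos \<otimes> cas_neg = \<one>"
proof -
  have "cas_pos \<otimes> cas_neg \<oplus> cas_pos \<otimes> cas_neg
      = (inv (\<one> \<oplus> \<one>) \<otimes> (\<one> \<oplus> \<one>)) \<otimes> (inv (\<one> \<oplus> \<one>) \<otimes> (\<one> \<ominus> j \<otimes> j))"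
    unfolding cas_pos_def cas_neg_def using half_closed j_closed by algebra
  also have "\<one> \<ominus> j \<otimes> j = \<one> \<oplus> \<one>" by (simp add: j_square minus_eq)
  finally show ?thesis by (simp add: half_two)
qed

lemma ff_cas_eq:
  "ff_cas R j \<alpha> k i = cas_pos \<otimes> \<alpha> [^] (i * k) \<oplus> cas_neg \<otimes> \<alpha> [^] (- (i * k))"
proof -
  \<comment> \<open>The inverse of \<open>2 * j\<close> is \<open>- j / 2\<close>, checked by
    multiplying out.\<close>
  have "((\<one> \<oplus> \<one>) \<otimes> j) \<otimes> (inv (\<one> \<oplus> \<one>) \<otimes> (\<ominus> j))
      = (inv (\<one> \<oplus> \<one>) \<otimes> (\<one> \<oplus> \<one>)) \<otimes> (\<ominus> (j \<otimes> j))"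
    using half_closed j_closed by algebra
  also have "\<dots> = \<one>" by (simp add: half_two j_square)
  finally have inv2j: "inv ((\<one> \<oplus> \<one>) \<otimes> j) = inv (\<one> \<oplus> \<one>) \<otimes> (\<ominus> j)"
    by (intro comm_inv_char) auto
  show ?thesis
    unfolding ff_cas_def ff_cos_def ff_sin_def inv2j cas_pos_def cas_neg_def
    using half_closed j_closed alpha_pow_closed[of "i * k"] alpha_pow_closed[of "- (i * k)"]
    by algebra
qed

lemma ff_cas_closed [simp]: "ff_cas R j \<alpha> k i \<in> carrier R"
  by (simp add: ff_cas_eq)

lemma ff_cas_commute: "ff_cas R j \<alpha> k i = ff_cas R j \<alpha> i k"
  by (simp add: ff_cas_eq mult.commute)

lemma ff_cas_cong:
  assumes "int N dvd k - l"
  shows "ff_cas R j \<alpha> k i = ff_cas R j \<alpha> l i"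
proof -
  have "int N dvd i * (k - l)" using assms by simp
  then have "\<alpha> [^] (i * k) = \<alpha> [^] (i * l)" "\<alpha> [^] (- (i * k)) = \<alpha> [^] (- (i * l))"
    by (intro alpha_pow_cong, simp add: algebra_simps dvd_diff_commute)+
  then show ?thesis by (simp add: ff_cas_eq)
qed

text \<open>The product expands into exponentials in \<open>\<plusminus>(k + l)\<close> and
  \<open>\<plusminus>(k - l)\<close>. The coefficients of the first pair sum to
  \<open>\<zero>\<close>, those of the second to \<open>\<one>\<close>.\<close>

lemma ff_cas_orthogonal:
  assumes "k < N" "l < N"
  shows "(\<Oplus>i\<in>{..<N}. ff_cas R j \<alpha> (int k) (int i) \<otimes> ff_cas R j \<alpha> (int l) (int i))
       = (if k = l then [N] \<cdot> \<one> else \<zero>)" (is "?lhs = _")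
proof -
  let ?e = "\<lambda>z i. \<alpha> [^] (int i * z)"
  let ?S = "\<lambda>z. \<Oplus>i\<in>{..<N}. ?e z i"
  let ?k = "int k" and ?l = "int l"
  \<comment> \<open>The sum depends only on whether \<open>N\<close> divides \<open>z\<close>, so
    opposite exponents give equal sums and their coefficients can be merged.\<close>
  have S: "?S (- z) = ?S z" for z by (simp only: finsum_alpha_pow dvd_minus_iff)
  have prod: "ff_cas R j \<alpha> ?k (int i) \<otimes> ff_cas R j \<alpha> ?l (int i)
      = cas_pos \<otimes> cas_pos \<otimes> ?e (?k + ?l) i \<oplus> cas_neg \<otimes> cas_neg \<otimes> ?e (- (?k + ?l)) i
        \<oplus> (cas_pos \<otimes> cas_neg \<otimes> ?e (?k - ?l) i \<oplus> cas_pos \<otimes> cas_neg \<otimes> ?e (- (?k - ?l)) i)" for i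
  proof -
    let ?a = "\<alpha> [^] (int i * ?k)" and ?a' = "\<alpha> [^] (- (int i * ?k))"
    let ?b = "\<alpha> [^] (int i * ?l)" and ?b' = "\<alpha> [^] (- (int i * ?l))"
    have e: "?e (?k + ?l) i = ?a \<otimes> ?b" "?e (- (?k + ?l)) i = ?a' \<otimes> ?b'"
      "?e (?k - ?l) i = ?a \<otimes> ?b'" "?e (- (?k - ?l)) i = ?a' \<otimes> ?b"
      by (simp_all add: algebra_simps flip: alpha_pow_add)
    have "?a \<in> carrier R" "?a' \<in> carrier R" "?b \<in> carrier R" "?b' \<in> carrier R" by simp_all
    then show ?thesis
      unfolding e ff_cas_eq using cas_pos_closed cas_neg_closed by algebra
  qed
  have "?lhs = cas_pos \<otimes> cas_pos \<otimes> ?S (?k + ?l) \<oplus> cas_neg \<otimes> cas_neg \<otimes> ?S (- (?k + ?l))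
        \<oplus> (cas_pos \<otimes> cas_neg \<otimes> ?S (?k - ?l) \<oplus> cas_pos \<otimes> cas_neg \<otimes> ?S (- (?k - ?l)))"
    unfolding prod by (simp add: finsum_addf finsum_rdistr)
  also have "\<dots> = (cas_pos \<otimes> cas_pos \<oplus> cas_neg \<otimes> cas_neg) \<otimes> ?S (?k + ?l)
        \<oplus> (cas_pos \<otimes> cas_neg \<oplus> cas_pos \<otimes> cas_neg) \<otimes> ?S (?k - ?l)"
    unfolding S by (simp add: l_distr)
  also have "\<dots> = ?S (?k - ?l)"
    by (simp add: cas_coeff_squares cas_coeff_mult)
  also have "\<dots> = (if int N dvd ?k - ?l then [N] \<cdot> \<one> else \<zero>)"
    by (rule finsum_alpha_pow)
  \<comment> \<open>Both indices lie below \<open>N\<close>, so congruence modulo \<open>N\<close>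
    is equality.\<close>
  also have "int N dvd ?k - ?l \<longleftrightarrow> k = l"
    using assms by (auto simp flip: mod_eq_dvd_iff)
  finally show ?thesis .
qed

text \<open>Up to the factor \<open>1 / N\<close> the transform is its own inverse: interchange the
  two sums and apply orthogonality to the inner one.\<close>

lemma ff_hartley_inverse:
  assumes V: "V \<in> {..<N} \<rightarrow> carrier R" and N: "[N] \<cdot> \<one> \<noteq> \<zero>" and k: "k < N"
  shows "ff_hartley R j \<alpha> N (\<lambda>i. inv ([N] \<cdot> \<one>) \<otimes> ff_hartley R j \<alpha> N V i) k = V k"
proof -
  let ?c = "\<lambda>k i. ff_cas R j \<alpha> (int k) (int i)"
  let ?n = "[N] \<cdot> \<one>"
  have n: "?n \<in> carrier R" "inv ?n \<in> carrier R" "inv ?n \<otimes> ?n = \<one>"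
    using N by (auto simp: field_Units)
  have Vc: "V l \<in> carrier R" if "l < N" for l using V that by auto
  have "ff_hartley R j \<alpha> N (\<lambda>i. inv ?n \<otimes> ff_hartley R j \<alpha> N V i) k
      = (\<Oplus>i\<in>{..<N}. \<Oplus>l\<in>{..<N}. inv ?n \<otimes> V l \<otimes> (?c k i \<otimes> ?c l i))"
    unfolding ff_hartley_def
  proof (intro finsum_cong' refl)
    fix i assume "i \<in> {..<N}"
    have "inv ?n \<otimes> (\<Oplus>l\<in>{..<N}. V l \<otimes> ?c i l) \<otimes> ?c k i
        = (\<Oplus>l\<in>{..<N}. inv ?n \<otimes> (V l \<otimes> ?c i l) \<otimes> ?c k i)"
      using n Vc by (simp add: finsum_ldistr finsum_rdistr Pi_def)
    \<comment> \<open>Symmetry of the kernel puts \<open>i\<close> in the same argument of both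
      kernel factors, the form required by orthogonality.\<close>
    also have "\<dots> = (\<Oplus>l\<in>{..<N}. inv ?n \<otimes> V l \<otimes> (?c k i \<otimes> ?c l i))"
      using n Vc by (intro finsum_cong') (auto simp: m_ac ff_cas_commute[of "int i"])
    finally show "inv ?n \<otimes> (\<Oplus>l\<in>{..<N}. V l \<otimes> ?c i l) \<otimes> ?c k i
        = (\<Oplus>l\<in>{..<N}. inv ?n \<otimes> V l \<otimes> (?c k i \<otimes> ?c l i))" .
  qed (use n Vc in \<open>auto intro!: finsum_closed\<close>)
  also have "\<dots> = (\<Oplus>l\<in>{..<N}. \<Oplus>i\<in>{..<N}. inv ?n \<otimes> V l \<otimes> (?c k i \<otimes> ?c l i))"
    using n Vc by (intro finsum_swap) auto
  also have "\<dots> = (\<Oplus>l\<in>{..<N}. if k = l then V l else \<zero>)"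
  proof (intro finsum_cong' refl)
    fix l assume l: "l \<in> {..<N}"
    have "(\<Oplus>i\<in>{..<N}. inv ?n \<otimes> V l \<otimes> (?c k i \<otimes> ?c l i))
        = inv ?n \<otimes> V l \<otimes> (\<Oplus>i\<in>{..<N}. ?c k i \<otimes> ?c l i)"
      using n Vc l by (intro finsum_rdistr[symmetric]) auto
    also have "\<dots> = (if k = l then V l else \<zero>)"
      using n Vc l k by (auto simp: ff_cas_orthogonal m_ac)
    finally show "(\<Oplus>i\<in>{..<N}. inv ?n \<otimes> V l \<otimes> (?c k i \<otimes> ?c l i)) = (if k = l then V l else \<zero>)" .
  qed (use Vc in auto)
  also have "\<dots> = V k" using k V by (intro finsum_singleton) auto
  finally show ?thesis .
qed

lemma ff_hartley_closed [simp]: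
  "v \<in> {..<N} \<rightarrow> carrier R \<Longrightarrow> ff_hartley R j \<alpha> N v k \<in> carrier R"
  unfolding ff_hartley_def by (intro finsum_closed) auto

text \<open>The map fixes \<open>1 / 2\<close> and negates \<open>j\<close>, so it swaps
  \<open>cas_pos\<close> and \<open>cas_neg\<close>; this swap accounts for the sign of the new
  index.\<close>

lemma ff_cas_frobenius:
  assumes p: "prime (p::nat)" "[p] \<cdot> \<one> = \<zero>" and j_q: "j [^] (p ^ r) = \<ominus> j"
  shows "(ff_cas R j \<alpha> k i) [^] (p ^ r) = ff_cas R j \<alpha> (- (k * int (p ^ r))) i"
proof -
  let ?q = "p ^ r"
  have "(\<one> \<oplus> \<one>) [^] ?q = \<one> \<oplus> \<one>" by (simp add: frobenius_add[OF p])
  then have half: "inv (\<one> \<oplus> \<one>) [^] ?q = inv (\<one> \<oplus> \<one>)"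
    using two_nonzero by (subst Units_inv_pow) (auto simp: field_Units)
  have pos: "cas_pos [^] ?q = cas_neg" and neg: "cas_neg [^] ?q = cas_pos"
    unfolding cas_pos_def cas_neg_def minus_eq
    by (simp_all add: nat_pow_distrib half frobenius_add[OF p] frobenius_minus[OF p] j_q)
  show ?thesis
    unfolding ff_cas_eq
    by (simp add: frobenius_add[OF p] nat_pow_distrib pos neg alpha_pow_pow a_comm mult.assoc)
qed

text \<open>The index \<open>l\<close> may be any natural number representing
  \<open>- k * p ^ r\<close> modulo \<open>N\<close>; the divisibility form avoids truncated
  subtraction.\<close>

lemma ff_hartley_frobenius:
  assumes p: "prime (p::nat)" "[p] \<cdot> \<one> = \<zero>" and j_q: "j [^] (p ^ r) = \<ominus> j"
    and v: "v \<in> {..<N} \<rightarrow> carrier R" and l: "int N dvd int k * int (p ^ r) + int l"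
  shows "(ff_hartley R j \<alpha> N v k) [^] (p ^ r) = ff_hartley R j \<alpha> N (\<lambda>i. v i [^] (p ^ r)) l"
proof -
  have c: "(ff_cas R j \<alpha> (int k) i) [^] (p ^ r) = ff_cas R j \<alpha> (int l) i" for i
  proof -
    have "int N dvd - (int k * int (p ^ r)) - int l"
      using l by (metis dvd_minus_iff minus_add_distrib diff_conv_add_uminus)
    then show ?thesis unfolding ff_cas_frobenius[OF p j_q] by (rule ff_cas_cong)
  qed
  have "(ff_hartley R j \<alpha> N v k) [^] (p ^ r)
      = (\<Oplus>i\<in>{..<N}. (v i \<otimes> ff_cas R j \<alpha> (int k) (int i)) [^] (p ^ r))"
    unfolding ff_hartley_def using v by (intro frobenius_finsum[OF p]) auto
  also have "\<dots> = ff_hartley R j \<alpha> N (\<lambda>i. v i [^] (p ^ r)) l"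
    unfolding ff_hartley_def using v by (intro finsum_cong') (auto simp: nat_pow_distrib c Pi_iff)
  finally show ?thesis .
qed

end

section \<open>The index map modulo \<open>N\<close>, and odd powers of \<open>j\<close>\<close>

lemma inj_on_mult_mod:
  fixes N q :: nat
  assumes "coprime N q"
  shows "inj_on (\<lambda>k. nat ((int N - int k * int q) mod int N)) {..<N}"
proof (rule inj_onI)
  fix k l assume kl: "k \<in> {..<N}" "l \<in> {..<N}"
    and eq: "nat ((int N - int k * int q) mod int N) = nat ((int N - int l * int q) mod int N)"
  have N: "N > 0" using kl by auto
  from eq have "(int N - int k * int q) mod int N = (int N - int l * int q) mod int N"
    using N by (simp add: nat_eq_iff)
  then have "int N dvd int q * (int l - int k)"
    by (simp add: mod_eq_dvd_iff algebra_simps)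
  \<comment> \<open>Coprimality allows \<open>q\<close> to be cancelled modulo
    \<open>N\<close>.\<close>
  then have "int N dvd int l - int k"
    using assms by (simp add: coprime_dvd_mult_right_iff)
  then show "k = l" using kl by (simp flip: mod_eq_dvd_iff)
qed

text \<open>Two further factors \<open>j\<close> only flip the sign. Which of the two values occurs
  for \<open>n = q\<close> is settled by \<open>j\<close> lying outside \<open>F\<close>.\<close>

lemma (in domain) odd_power_square_root_minus_one:
  assumes "j \<in> carrier R" "j \<otimes> j = \<ominus> \<one>" "odd n"
  shows "j [^] (n::nat) = j \<or> j [^] n = \<ominus> j"
proof -
  have "j [^] (2 * m + 1) = j \<or> j [^] (2 * m + 1) = \<ominus> j" for m :: nat
  proof (induction m)
    case (Suc m)
    have "j [^] (2 * Suc m + 1) = j [^] (2 * m + 1) \<otimes> (j \<otimes> j)"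
      using assms(1) by (simp add: m_assoc)
    with Suc assms(1,2) show ?case by (auto simp: r_minus)
  qed (use assms in auto)
  with assms(3) show ?thesis by (elim oddE) auto
qed

section \<open>The conjugacy criterion for Hartley spectra\<close>

theorem lemma2:
  fixes L :: "('a, 'b) ring_scheme" (structure)
    and F K :: "'a set"
    and p r q m N :: nat
    and \<alpha> j :: 'a
    and V :: "nat \<Rightarrow> 'a"
  assumes "prime p" and "odd p" and "r \<ge> 1" and "q = p ^ r" and "m \<ge> 1"
    and "field L"
    and "subfield K L" and "card K = q ^ m"
    and "subfield F L" and "card F = q" and "F \<subseteq> K"
    and "\<not> (\<exists>x\<in>F. x [^] (2::nat) = \<ominus> \<one>)"
    and "j \<in> carrier L" and "j [^] (2::nat) = \<ominus> \<one>"
    and "N dvd q ^ m - 1"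
    and "\<alpha> \<in> K - {\<zero>}" and "group.ord (mult_of L) \<alpha> = N"
    and "V \<in> {..<N} \<rightarrow> K"
  shows "(\<exists>v. v \<in> {..<N} \<rightarrow> F \<and> (\<forall>k<N. V k = ff_hartley L j \<alpha> N v k)) \<longleftrightarrow>
         (\<forall>k<N. V k [^] q = V (nat ((int N - int k * int q) mod int N)))"
proof -
  interpret L: field L by fact
  let ?H = "ff_hartley L j \<alpha> N"
  define \<sigma> where "\<sigma> = (\<lambda>k. nat ((int N - int k * int q) mod int N))"
  have carr: "K \<subseteq> carrier L" "F \<subseteq> carrier L"
    using subfieldE(3) assms(7,9) by auto
  have q: "q > 1"
    unfolding assms(4) using prime_gt_1_nat[OF assms(1)] assms(3) by (intro one_less_power) auto
  have finF: "finite F" using assms(10) q card.infinite[of F] by fastforce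
  have fixF: "x [^] q = x" if "x \<in> F" for x
    using L.subfield_power_card[OF assms(9) finF that] assms(10) by simp
  have q0: "[q] \<cdot> \<one> = \<zero>"
    using L.subfield_add_pow_card[OF assms(9)] assms(10) by simp
  then have p0: "[p] \<cdot> \<one> = \<zero>"
    unfolding assms(4) by (rule L.add_pow_one_prime_power)
  note frob = assms(1) p0
  have no_zero: "[n] \<cdot> \<one> \<noteq> \<zero>" if "n dvd s" "[s] \<cdot> \<one> \<noteq> \<zero>" for n s :: nat
    using that L.add_pow_dvd_zero[of n s \<one>] by auto
  \<comment> \<open>Consecutive multiples of \<open>\<one>\<close> differ by \<open>\<one>\<close>,
    so they cannot both vanish.\<close>
  have Suc_zero: "[n] \<cdot> \<one> \<noteq> \<zero>" if "[(Suc n)] \<cdot> \<one> = \<zero>" for n :: nat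
    using that by auto
  have "q ^ m > 0" using q by simp
  moreover have "[(q ^ m)] \<cdot> \<one> = \<zero>"
    using L.add_pow_dvd_zero[OF q0] assms(5) by (simp add: dvd_power)
  \<comment> \<open>\<open>q ^ m\<close> vanishes in \<open>L\<close>, so \<open>q ^ m - 1\<close>
    does not, and neither does its divisor \<open>N\<close>.\<close>
  ultimately have N0: "[N] \<cdot> \<one> \<noteq> \<zero>"
    using Suc_zero[of "q ^ m - 1"] by (intro no_zero[OF assms(15)]) simp
  have N: "N > 0" using N0 by (intro Nat.gr0I) simp
  have two: "\<one> \<oplus> \<one> \<noteq> \<zero>"
  proof -
    obtain c where c: "p = Suc (2 * c)" using assms(2) by (elim oddE) simp
    \<comment> \<open>Since \<open>p = 2 * c + 1\<close> vanishes in \<open>L\<close>, the number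
      \<open>2 * c\<close> does not, and hence neither does \<open>2\<close>.\<close>
    have "[(2 * c)] \<cdot> \<one> \<noteq> \<zero>" using Suc_zero[of "2 * c"] p0 c by simp
    then have "[(2::nat)] \<cdot> \<one> \<noteq> \<zero>" by (intro no_zero[of 2 "2 * c"]) auto
    then show ?thesis by (simp add: numeral_2_eq_2)
  qed
  have jj: "j \<otimes> j = \<ominus> \<one>"
    using assms(13,14) by (simp add: numeral_2_eq_2)
  interpret hartley_kernel L \<alpha> j N
    by unfold_locales (use assms(13,16,17) carr jj two in auto)
  have j_q: "j [^] q = \<ominus> j"
  proof -
    \<comment> \<open>\<open>F\<close> contains every fixed point of
      \<open>x \<mapsto> x ^ q\<close>, while \<open>j\<close> is not in \<open>F\<close> because
      \<open>-1\<close> is a non-residue there.\<close>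
    have "j [^] q \<noteq> j"
      using L.subfield_fixed_points[OF assms(9) finF assms(13)] assms(10,12,14) by auto
    moreover have "odd q" using assms(2,4) by simp
    ultimately show ?thesis
      using L.odd_power_square_root_minus_one[OF assms(13) jj] by blast
  qed
  have \<sigma>: "\<sigma> k < N" "int N dvd int k * int q + int (\<sigma> k)" for k
  proof -
    have nn: "int (\<sigma> k) = (int N - int k * int q) mod int N"
      using N by (simp add: \<sigma>_def)
    then show "\<sigma> k < N" using N by (metis of_nat_less_iff of_nat_0_less_iff pos_mod_bound)
    have "(int k * int q + int (\<sigma> k)) mod int N = 0"
      unfolding nn by (simp add: mod_simps)
    then show "int N dvd int k * int q + int (\<sigma> k)" by auto
  qed
  have "coprime N q"
  proof (rule coprimeI)
    fix d assume d: "d dvd N" "d dvd q"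
    \<comment> \<open>A common divisor divides the consecutive numbers \<open>q ^ m\<close> and
      \<open>q ^ m - 1\<close>.\<close>
    have "d dvd q ^ m" using d(2) assms(5) by (simp add: dvd_power_same dvd_trans[OF _ dvd_power])
    moreover have "d dvd q ^ m - 1" using d(1) assms(15) by (rule dvd_trans)
    ultimately show "is_unit d" using \<open>q ^ m > 0\<close> by (metis One_nat_def Suc_pred dvd_add_right_iff plus_1_eq_Suc add.commute)
  qed
  then have inj: "inj_on \<sigma> {..<N}" unfolding \<sigma>_def by (rule inj_on_mult_mod)
  \<comment> \<open>An injective self-map of a finite set is a permutation.\<close>
  then have img: "\<sigma> ` {..<N} = {..<N}"
    using \<sigma>(1) by (intro endo_inj_surj) auto
  have H_frob: "?H v k [^] q = ?H (\<lambda>i. v i [^] q) (\<sigma> k)"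
    if "v \<in> {..<N} \<rightarrow> carrier L" for v k
    using ff_hartley_frobenius[OF frob _ that, of r k "\<sigma> k"] \<sigma>(2) j_q assms(4) by simp
  show ?thesis
  proof (intro iffI; (elim exE conjE)?)
    fix v assume v: "v \<in> {..<N} \<rightarrow> F" "\<forall>k<N. V k = ?H v k"
    have "V k [^] q = V (\<sigma> k)" if "k < N" for k
    proof -
      have vc: "v \<in> {..<N} \<rightarrow> carrier L" using v(1) carr by auto
      have "V k [^] q = ?H (\<lambda>i. v i [^] q) (\<sigma> k)" using v that H_frob[OF vc] by simp
      also have "\<dots> = ?H v (\<sigma> k)"
        unfolding ff_hartley_def using v(1) vc fixF
        by (intro L.finsum_cong') (auto simp: Pi_iff)
      finally show ?thesis using v(2) \<sigma>(1) by simp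
    qed
    then show "\<forall>k<N. V k [^] q = V (nat ((int N - int k * int q) mod int N))"
      by (simp add: \<sigma>_def)
  next
    assume "\<forall>k<N. V k [^] q = V (nat ((int N - int k * int q) mod int N))"
    then have V: "V k [^] q = V (\<sigma> k)" if "k < N" for k using that by (simp add: \<sigma>_def)
    have Vc: "V \<in> {..<N} \<rightarrow> carrier L" using assms(18) carr by auto
    \<comment> \<open>The only candidate, dictated by the inversion formula; it remains to see that
      its values lie in \<open>F\<close>.\<close>
    define v where "v = (\<lambda>i. inv ([N] \<cdot> \<one>) \<otimes> ?H V i)"
    have n: "[N] \<cdot> \<one> \<in> Units L" using N0 by (simp add: L.field_Units)
    then have "inv ([N] \<cdot> \<one>) [^] q = inv ([N] \<cdot> \<one>)"
      using L.frobenius_add_pow_one[OF frob] assms(4) by (simp add: L.Units_inv_pow)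
    moreover have "?H V i [^] q = ?H V i" for i
    proof -
      let ?c = "\<lambda>k. ff_cas L j \<alpha> (int k) (int i)"
      \<comment> \<open>By symmetry the summation index \<open>k\<close> can serve as the frequency,
        so the \<open>q\<close>-th power moves \<open>k\<close> and leaves \<open>i\<close>
        alone.\<close>
      have c: "ff_cas L j \<alpha> (int i) (int k) = ?c k" for k by (rule ff_cas_commute)
      have "?H V i [^] q = (\<Oplus>k\<in>{..<N}. (V k \<otimes> ?c k) [^] q)"
        unfolding ff_hartley_def c assms(4) using Vc by (intro L.frobenius_finsum[OF frob]) auto
      also have "\<dots> = (\<Oplus>k\<in>{..<N}. V (\<sigma> k) \<otimes> ?c (\<sigma> k))"
      proof (intro L.finsum_cong' refl)
        fix k assume k: "k \<in> {..<N}"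
        have "int N dvd - (int k * int q) - int (\<sigma> k)"
          using \<sigma>(2)[of k] by (metis dvd_minus_iff minus_add_distrib diff_conv_add_uminus)
        then have "?c k [^] q = ?c (\<sigma> k)"
          using ff_cas_frobenius[OF frob, of r "int k" "int i"] j_q assms(4) ff_cas_cong by simp
        with k V Vc show "(V k \<otimes> ?c k) [^] q = V (\<sigma> k) \<otimes> ?c (\<sigma> k)"
          by (auto simp: L.nat_pow_distrib Pi_iff)
      qed (use Vc \<sigma>(1) in \<open>auto simp: Pi_iff\<close>)
      \<comment> \<open>Both factors have moved along the same permutation \<open>\<sigma>\<close>,
        so the sum is only reordered.\<close>
      also have "\<dots> = (\<Oplus>k\<in>\<sigma> ` {..<N}. V k \<otimes> ?c k)"
        using Vc \<sigma>(1) by (intro L.finsum_reindex[symmetric] inj) (auto simp: Pi_iff)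
      finally show ?thesis unfolding ff_hartley_def c img .
    qed
    moreover have Hc: "?H V i \<in> carrier L" for i using Vc by (rule ff_hartley_closed)
    ultimately have "v i [^] q = v i" for i
      using n by (simp add: v_def L.nat_pow_distrib)
    moreover have "v i \<in> carrier L" for i using n Hc by (simp add: v_def)
    ultimately have "v \<in> {..<N} \<rightarrow> F"
      using L.subfield_fixed_points[OF assms(9) finF] assms(10) by auto
    moreover have "\<forall>k<N. V k = ?H v k"
      unfolding v_def using ff_hartley_inverse[OF Vc N0] by simp
    ultimately show "\<exists>v. v \<in> {..<N} \<rightarrow> F \<and> (\<forall>k<N. V k = ?H v k)" by blast
  qed
qed

end
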